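(* Consider an instance of the maintenance scheduling problem in which the input data is integer (all capacities $u_x$, all processing times $p_a$, release times $r_a$, deadlines $d_a$, and the time horizon $T$ are integers) and there are no storage nodes, i.e. $W=\varnothing$. Then there is an integral optimal solution, i.e. an optimal solution $t^*=(t^*_a)_{a\in A_1}$ of $\varphi^*=\max\{\operatorname{val}(t^* ) : t^*\in X\}$ with $t^*_a\in\mathbb{Z}$ for all $a\in A_1$.
   Context: The maintenance scheduling problem. $N=(V,A,s,t)$ is a finite directed network (parallel arcs allowed) with distinct source $s$ and sink $t$; $\delta^{\text{out}}(v)$ and $\delta^{\text{in}}(v)$ are the sets of arcs starting, respectively ending, at $v$. $W\subseteq V\setminus\{s,t\}$ is a set of storage nodes, and $u=(u_x)_{x\in A\cup W}$ are nonnegative capacities (flow per unit time for arcs, stored amount for nodes in $W$). $T>0$ is the time horizon. $A_1\subseteq A$ is the set of arcs with a maintenance job; each $a\in A_1$ has exactly one job, with processing time $p_a>0$, release time $r_a$ and deadline $d_a$, where $0\leqslant r_a\leqslant d_a-p_a$ and $d_a\leqslant T$. A feasible solution is a start time vector $t^*=(t^*_a)_{a\in A_1}\in X:=\prod_{a\in A_1}[r_a,d_a-p_a]$. Value of a solution. Given $t^*\in X$, let $0=t_0<t_1<\cdots<t_n=T$ be the increasing enumeration of the set $\{t^*_a : a\in A_1\}\cup\{t^*_a+p_a : a\in A_1\}\cup\{0,T\}$, and for $a\in A_1$ let $I_a=\{i\in\{1,\dots,n\} : t^*_a<t_i\leqslant t^*_a+p_a\}$. Then $\operatorname{val}(t^*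 )$ is the maximum of $\sum_{i=1}^n\big(\sum_{a\in\delta^{\text{out}}(s)}x_{ai}-\sum_{a\in\delta^{\text{in}}(s)}x_{ai}\big)$ over all nonnegative reals $x_{ai}$ ($a\in A$, $1\leqslant i\leqslant n$) and $x_{vi}$ ($v\in W$, $0\leqslant i\leqslant n$) satisfying: $\sum_{a\in\delta^{\text{out}}(v)}x_{ai}=\sum_{a\in\delta^{\text{in}}(v)}x_{ai}$ for $v\in V\setminus(W\cup\{s,t\})$, $1\leqslant i\leqslant n$; $\sum_{a\in\delta^{\text{out}}(v)}x_{ai}+x_{vi}=\sum_{a\in\delta^{\text{in}}(v)}x_{ai}+x_{v,i-1}$ for $v\in W$, $1\leqslant i\leqslant n$; $x_{ai}\leqslant(t_i-t_{i-1})u_a$ for $a\in A\setminus A_1$ and all $i$, and for $a\in A_1$ and $i\notin I_a$; $x_{ai}=0$ for $a\in A_1$, $i\in I_a$; $x_{vi}\leqslant u_v$ for $v\in W$, $0\leqslant i\leqslant n$; $x_{v0}=x_{vn}=0$ for $v\in W$. The problem is to determine $\varphi^*=\max\{\operatorname{val}(t^* ) : t^*\in X\}$; an optimal solution is a $t^*\in X$ attaining this maximum. *)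

theory Defs
  imports Complex_Main "HOL-Library.FuncSet" "Graph_Theory.Digraph"
begin

text \<open>
  Capacities are split into two functions, one for arcs and one for storage nodes.
  The functions \<open>processing_time\<close>, \<open>release_time\<close> and \<open>deadline\<close> are only relevant
  on \<open>job_arcs\<close>.
\<close>

record ('v, 'a) maintenance_instance =
  network :: "('v, 'a) pre_digraph"
  source :: 'v
  sink :: 'v
  storage :: "'v set"
  arc_capacity :: "'a \<Rightarrow> real"
  storage_capacity :: "'v \<Rightarrow> real"
  horizon :: real
  job_arcs :: "'a set"
  processing_time :: "'a \<Rightarrow> real"
  release_time :: "'a \<Rightarrow> real"
  deadline :: "'a \<Rightarrow> real"

locale maintenance_problem =
  fixes P :: "('v, 'a) maintenance_instance"
  assumes fin_digraph_network: "fin_digraph (network P)"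
    and source_in_verts: "source P \<in> verts (network P)"
    and sink_in_verts: "sink P \<in> verts (network P)"
    and source_neq_sink: "source P \<noteq> sink P"
    and storage_subset: "storage P \<subseteq> verts (network P) - {source P, sink P}"
    and arc_capacity_nonneg: "\<And>a. a \<in> arcs (network P) \<Longrightarrow> 0 \<le> arc_capacity P a"
    and storage_capacity_nonneg: "\<And>v. v \<in> storage P \<Longrightarrow> 0 \<le> storage_capacity P v"
    and horizon_pos: "0 < horizon P"
    and job_arcs_subset: "job_arcs P \<subseteq> arcs (network P)"
    and processing_time_pos: "\<And>a. a \<in> job_arcs P \<Longrightarrow> 0 < processing_time P a"
    and release_time_nonneg: "\<And>a. a \<in> job_arcs P \<Longrightarrow> 0 \<le> release_time P a"
    and release_time_le:
      "\<And>a. a \<in> job_arcs P \<Longrightarrow> release_time P a \<le> deadline P a - processing_time P a"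
    and deadline_le: "\<And>a. a \<in> job_arcs P \<Longrightarrow> deadline P a \<le> horizon P"

definition integral_data :: "('v, 'a) maintenance_instance \<Rightarrow> bool" where
  "integral_data P \<longleftrightarrow>
     (\<forall>a \<in> arcs (network P). arc_capacity P a \<in> \<int>) \<and>
     (\<forall>v \<in> storage P. storage_capacity P v \<in> \<int>) \<and>
     horizon P \<in> \<int> \<and>
     (\<forall>a \<in> job_arcs P.
        processing_time P a \<in> \<int> \<and> release_time P a \<in> \<int> \<and> deadline P a \<in> \<int>)"

definition feasible_starts :: "('v, 'a) maintenance_instance \<Rightarrow> ('a \<Rightarrow> real) set" where
  "feasible_starts P =
     (\<Pi>\<^sub>E a \<in> job_arcs P. {release_time P a .. deadline P a - processing_time P a})"

definition time_points :: "('v, 'a) maintenance_instance \<Rightarrow> ('a \<Rightarrow> real) \<Rightarrow> real list" where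
  "time_points P ts = sorted_list_of_set
     ((\<lambda>a. ts a) ` job_arcs P \<union> (\<lambda>a. ts a + processing_time P a) ` job_arcs P
        \<union> {0, horizon P})"

definition time_point :: "('v, 'a) maintenance_instance \<Rightarrow> ('a \<Rightarrow> real) \<Rightarrow> nat \<Rightarrow> real" where
  "time_point P ts i = time_points P ts ! i"

definition num_intervals :: "('v, 'a) maintenance_instance \<Rightarrow> ('a \<Rightarrow> real) \<Rightarrow> nat" where
  "num_intervals P ts = length (time_points P ts) - 1"

definition closed_intervals ::
    "('v, 'a) maintenance_instance \<Rightarrow> ('a \<Rightarrow> real) \<Rightarrow> 'a \<Rightarrow> nat set" where
  "closed_intervals P ts a =
     {i \<in> {1..num_intervals P ts}.
        ts a < time_point P ts i \<and> time_point P ts i \<le> ts a + processing_time P a}"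

text \<open>
  \<open>x a i\<close> is the total flow on arc \<open>a\<close> during the \<open>i\<close>-th interval, \<open>y v i\<close> the amount stored
  at \<open>v\<close> at the \<open>i\<close>-th time point. Values of \<open>x\<close> and \<open>y\<close> outside the index ranges of the
  linear program are unconstrained and do not enter the objective.
\<close>

definition feasible_flow ::
    "('v, 'a) maintenance_instance \<Rightarrow> ('a \<Rightarrow> real) \<Rightarrow> ('a \<Rightarrow> nat \<Rightarrow> real) \<Rightarrow> ('v \<Rightarrow> nat \<Rightarrow> real) \<Rightarrow> bool"
  where
  "feasible_flow P ts x y \<longleftrightarrow>
     (let N = network P; n = num_intervals P ts; t = time_point P ts in
       (\<forall>a \<in> arcs N. \<forall>i \<in> {1..n}. 0 \<le> x a i) \<and>
       (\<forall>v \<in> storage P. \<forall>i \<in> {0..n}. 0 \<le> y v i) \<and>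
       (\<forall>v \<in> verts N - (storage P \<union> {source P, sink P}). \<forall>i \<in> {1..n}.
          (\<Sum>a \<in> out_arcs N v. x a i) = (\<Sum>a \<in> in_arcs N v. x a i)) \<and>
       (\<forall>v \<in> storage P. \<forall>i \<in> {1..n}.
          (\<Sum>a \<in> out_arcs N v. x a i) + y v i = (\<Sum>a \<in> in_arcs N v. x a i) + y v (i - 1)) \<and>
       (\<forall>a \<in> arcs N - job_arcs P. \<forall>i \<in> {1..n}. x a i \<le> (t i - t (i - 1)) * arc_capacity P a) \<and>
       (\<forall>a \<in> job_arcs P. \<forall>i \<in> {1..n} - closed_intervals P ts a.
          x a i \<le> (t i - t (i - 1)) * arc_capacity P a) \<and>
       (\<forall>a \<in> job_arcs P. \<forall>i \<in> closed_intervals P ts a. x a i = 0) \<and>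
       (\<forall>v \<in> storage P. \<forall>i \<in> {0..n}. y v i \<le> storage_capacity P v) \<and>
       (\<forall>v \<in> storage P. y v 0 = 0 \<and> y v n = 0))"

definition flow_value ::
    "('v, 'a) maintenance_instance \<Rightarrow> ('a \<Rightarrow> real) \<Rightarrow> ('a \<Rightarrow> nat \<Rightarrow> real) \<Rightarrow> real" where
  "flow_value P ts x =
     (\<Sum>i = 1..num_intervals P ts.
        (\<Sum>a \<in> out_arcs (network P) (source P). x a i)
        - (\<Sum>a \<in> in_arcs (network P) (source P). x a i))"

text \<open>The maximum is attained: the linear program is feasible and bounded.\<close>

definition schedule_value :: "('v, 'a) maintenance_instance \<Rightarrow> ('a \<Rightarrow> real) \<Rightarrow> real" where
  "schedule_value P ts = (GREATEST z. \<exists>x y. feasible_flow P ts x y \<and> z = flow_value P ts x)"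

definition optimal_solution :: "('v, 'a) maintenance_instance \<Rightarrow> ('a \<Rightarrow> real) \<Rightarrow> bool" where
  "optimal_solution P ts \<longleftrightarrow> is_arg_max (schedule_value P) (\<lambda>t. t \<in> feasible_starts P) ts"

end

theory Submission
  imports Defs "HOL-Analysis.Function_Topology" "HOL-Analysis.Henstock_Kurzweil_Integration"
begin

text \<open>
  Without storage the intervals decouple, so the value of a schedule is the integral over
  \<open>\<tau> \<in> [0, T]\<close> of the maximum flow rate avoiding the arcs closed at time \<open>\<tau>\<close>. For
  \<open>\<theta> \<in> [0, 1)\<close> replace every start time \<open>t\<close> by \<open>\<lfloor>t + \<theta>\<rfloor>\<close>. With integral processing
  times, the arcs closed by the new schedule during \<open>(k, k + 1]\<close> are exactly those closed by the
  old one at time \<open>k + 1 - \<theta>\<close>. Hence the average over \<open>\<theta>\<close> of the values of the rounded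
  schedules is the value of the original one, and some rounding is at least as good. As there are
  only finitely many integral schedules, the best of them is optimal.
\<close>

section \<open>Maximum flow rates\<close>

text \<open>\<open>S\<close> is the set of closed arcs. They stay in the network with capacity 0, so
  the same digraph serves every configuration of closed arcs.\<close>

definition unit_flow :: "('v, 'a) maintenance_instance \<Rightarrow> 'a set \<Rightarrow> ('a \<Rightarrow> real) \<Rightarrow> bool" where
  "unit_flow P S f \<longleftrightarrow>
     (\<forall>a \<in> arcs (network P). 0 \<le> f a \<and> f a \<le> (if a \<in> S then 0 else arc_capacity P a)) \<and>
     (\<forall>v \<in> verts (network P) - {source P, sink P}.
        (\<Sum>a \<in> out_arcs (network P) v. f a) = (\<Sum>a \<in> in_arcs (network P) v. f a))"

definition net_outflow :: "('v, 'a) maintenance_instance \<Rightarrow> ('a \<Rightarrow> real) \<Rightarrow> real" where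
  "net_outflow P f =
     (\<Sum>a \<in> out_arcs (network P) (source P). f a) - (\<Sum>a \<in> in_arcs (network P) (source P). f a)"

definition max_flow_rate :: "('v, 'a) maintenance_instance \<Rightarrow> 'a set \<Rightarrow> real" where
  "max_flow_rate P S = (GREATEST z. \<exists>f. unit_flow P S f \<and> z = net_outflow P f)"

text \<open>The interval is open on the left and closed on the right, as in
  \<open>closed_intervals\<close>. Hence the configuration on a whole interval between time points
  can be read off at its right end.\<close>

definition closed_arcs :: "('v, 'a) maintenance_instance \<Rightarrow> ('a \<Rightarrow> real) \<Rightarrow> real \<Rightarrow> 'a set" where
  "closed_arcs P ts \<tau> = {a \<in> job_arcs P. ts a < \<tau> \<and> \<tau> \<le> ts a + processing_time P a}"

lemma unit_flow_cong:
  assumes "\<And>a. a \<in> arcs (network P) \<Longrightarrow> f a = g a"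
  shows "unit_flow P S f \<longleftrightarrow> unit_flow P S g"
proof -
  have "(\<Sum>a \<in> out_arcs (network P) v. f a) = (\<Sum>a \<in> out_arcs (network P) v. g a)"
    "(\<Sum>a \<in> in_arcs (network P) v. f a) = (\<Sum>a \<in> in_arcs (network P) v. g a)" for v
    using assms by (auto intro!: sum.cong)
  then show ?thesis unfolding unit_flow_def using assms by auto
qed

lemma net_outflow_cong:
  assumes "\<And>a. a \<in> arcs (network P) \<Longrightarrow> f a = g a"
  shows "net_outflow P f = net_outflow P g"
proof -
  have "(\<Sum>a \<in> out_arcs (network P) v. f a) = (\<Sum>a \<in> out_arcs (network P) v. g a)"
    "(\<Sum>a \<in> in_arcs (network P) v. f a) = (\<Sum>a \<in> in_arcs (network P) v. g a)" for v
    using assms by (auto intro!: sum.cong)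
  then show ?thesis unfolding net_outflow_def by simp
qed

lemma net_outflow_scale: "net_outflow P (\<lambda>a. c * f a) = c * net_outflow P f"
  by (simp add: net_outflow_def sum_distrib_left right_diff_distrib)

text \<open>Tychonoff's theorem, carried from the abstract product topology to the type class
  topology on functions.\<close>

lemma compact_PiE_UNIV:
  fixes K :: "'i \<Rightarrow> 'b::topological_space set"
  assumes "\<And>i. compact (K i)"
  shows "compact (PiE UNIV K)"
proof -
  have "compactin (product_topology (\<lambda>i. euclidean) UNIV) (PiE UNIV K)"
    using assms by (auto simp: compactin_PiE)
  then show ?thesis by (simp add: euclidean_product_topology)
qed

context maintenance_problem
begin

text \<open>The extreme value theorem: the net outflow is continuous in the flow, and the flows that
  vanish off the network form a nonempty compact set.\<close>

lemma unit_flow_max_exists: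
  obtains f where "unit_flow P S f" "\<And>g. unit_flow P S g \<Longrightarrow> net_outflow P g \<le> net_outflow P f"
proof -
  define N where "N = network P"
  \<comment> \<open>The bound 0 off the network pins the irrelevant coordinates, which makes the box
    \<open>K\<close> a product of compact intervals over the whole type.\<close>
  define u where "u a = (if a \<in> arcs N then if a \<in> S then 0 else arc_capacity P a else 0)" for a
  define K where "K = PiE UNIV (\<lambda>a. {0..u a})"
  define D where
    "D v = {f :: 'a \<Rightarrow> real. (\<Sum>a \<in> out_arcs N v. f a) = (\<Sum>a \<in> in_arcs N v. f a)}" for v
  define Q where "Q = K \<inter> (\<Inter>v \<in> verts N - {source P, sink P}. D v)"
  have cont: "continuous_on A (\<lambda>f. \<Sum>a \<in> B. f a)" for A :: "('a \<Rightarrow> real) set" and B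
    by (intro continuous_on_sum continuous_on_subset[OF continuous_on_product_coordinates]) simp
  have "closed (D v)" for v
    unfolding D_def by (intro closed_Collect_eq cont)
  then have "compact Q"
    unfolding Q_def K_def by (intro compact_Int_closed compact_PiE_UNIV closed_INT) auto
  moreover have "(\<lambda>a. 0) \<in> Q"
    using arc_capacity_nonneg by (auto simp: Q_def K_def u_def D_def N_def)
  then have "Q \<noteq> {}" by blast
  moreover have "continuous_on Q (net_outflow P)"
    unfolding net_outflow_def by (intro continuous_on_diff cont)
  ultimately obtain f where f: "f \<in> Q" "\<And>g. g \<in> Q \<Longrightarrow> net_outflow P g \<le> net_outflow P f"
    using continuous_attains_sup[of Q "net_outflow P"] by blast
  show thesis
  proof
    show "unit_flow P S f"
      unfolding unit_flow_def
    proof (intro conjI ballI)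
      fix a assume "a \<in> arcs (network P)"
      moreover have "f a \<in> {0..u a}" using f(1) by (auto simp: Q_def K_def PiE_iff)
      ultimately show "0 \<le> f a" "f a \<le> (if a \<in> S then 0 else arc_capacity P a)"
        by (simp_all add: u_def N_def)
    next
      fix v assume "v \<in> verts (network P) - {source P, sink P}"
      then show "(\<Sum>a \<in> out_arcs (network P) v. f a) = (\<Sum>a \<in> in_arcs (network P) v. f a)"
        using f(1) by (auto simp: Q_def D_def N_def)
    qed
  next
    fix g assume g: "unit_flow P S g"
    \<comment> \<open>A competitor may take any values off the network. Setting these to 0 puts it
      into \<open>Q\<close> and keeps its net outflow.\<close>
    define h where "h a = (if a \<in> arcs N then g a else 0)" for a
    have "unit_flow P S h"
      using g unit_flow_cong[of P h g S] by (simp add: h_def N_def)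
    then have "h \<in> Q"
      unfolding unit_flow_def Q_def K_def D_def u_def N_def by (auto simp: h_def N_def)
    then show "net_outflow P g \<le> net_outflow P f"
      using f(2)[of h] net_outflow_cong[of P h g] by (simp add: h_def N_def)
  qed
qed

lemma max_flow_rate:
  shows max_flow_rate_attained: "\<exists>f. unit_flow P S f \<and> net_outflow P f = max_flow_rate P S"
    and max_flow_rate_upper: "unit_flow P S g \<Longrightarrow> net_outflow P g \<le> max_flow_rate P S"
proof -
  obtain f where f: "unit_flow P S f"
    "\<And>g. unit_flow P S g \<Longrightarrow> net_outflow P g \<le> net_outflow P f"
    using unit_flow_max_exists[of S] by blast
  then have "max_flow_rate P S = net_outflow P f"
    unfolding max_flow_rate_def by (intro Greatest_equality) auto
  then show "\<exists>f. unit_flow P S f \<and> net_outflow P f = max_flow_rate P S"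
    "unit_flow P S g \<Longrightarrow> net_outflow P g \<le> max_flow_rate P S"
    using f by auto
qed

lemma finite_job_arcs: "finite (job_arcs P)"
  using fin_digraph.finite_arcs[OF fin_digraph_network] job_arcs_subset finite_subset by blast

section \<open>The value of a schedule as an integral\<close>

lemma time_points_props:
  assumes "ts \<in> feasible_starts P"
  shows set_time_points: "set (time_points P ts) =
      ts ` job_arcs P \<union> (\<lambda>a. ts a + processing_time P a) ` job_arcs P \<union> {0, horizon P}"
    and time_point_strict_mono:
      "\<lbrakk>i < j; j \<le> num_intervals P ts\<rbrakk> \<Longrightarrow> time_point P ts i < time_point P ts j"
    and time_point_0: "time_point P ts 0 = 0"
    and time_point_last: "time_point P ts (num_intervals P ts) = horizon P"
    and time_point_index:
      "x \<in> set (time_points P ts) \<Longrightarrow> \<exists>i \<le> num_intervals P ts. x = time_point P ts i"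
proof -
  define l where "l = time_points P ts"
  show set: "set (time_points P ts) =
      ts ` job_arcs P \<union> (\<lambda>a. ts a + processing_time P a) ` job_arcs P \<union> {0, horizon P}"
    unfolding time_points_def using finite_job_arcs by (intro set_sorted_list_of_set) simp
  have ne: "l \<noteq> []" using set by (auto simp: l_def)
  have len: "i < length l \<longleftrightarrow> i \<le> num_intervals P ts" for i
    using ne by (cases l) (auto simp: num_intervals_def l_def)
  have sorted: "sorted_wrt (<) l" by (simp add: l_def time_points_def)
  show mono: "\<lbrakk>i < j; j \<le> num_intervals P ts\<rbrakk> \<Longrightarrow> time_point P ts i < time_point P ts j" for i j
    using sorted_wrt_nth_less[OF sorted, of i j] len[of j] by (simp add: time_point_def l_def)
  show index: "x \<in> set (time_points P ts) \<Longrightarrow> \<exists>i \<le> num_intervals P ts. x = time_point P ts i" for x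
    using len by (auto simp: in_set_conv_nth time_point_def l_def)
  have in_set: "i \<le> num_intervals P ts \<Longrightarrow> time_point P ts i \<in> set (time_points P ts)" for i
    using len[of i] by (simp add: time_point_def l_def)
  \<comment> \<open>All jobs run within the horizon, so 0 and \<open>horizon P\<close> are the
    extreme points of the enumeration.\<close>
  have bounds: "0 \<le> x \<and> x \<le> horizon P" if "x \<in> set (time_points P ts)" for x
  proof -
    have "0 \<le> ts a \<and> ts a + processing_time P a \<le> horizon P \<and> 0 < processing_time P a"
      if "a \<in> job_arcs P" for a
      using assms that release_time_nonneg[OF that] deadline_le[OF that] processing_time_pos[OF that]
      by (force simp: feasible_starts_def PiE_iff)
    then show ?thesis using that horizon_pos unfolding set by force
  qed
  obtain i where i: "i \<le> num_intervals P ts" "0 = time_point P ts i"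
    using index[of 0] set by auto
  then show "time_point P ts 0 = 0"
    using mono[of 0 i] bounds[OF in_set[of 0]] by (cases "i = 0") auto
  obtain j where j: "j \<le> num_intervals P ts" "horizon P = time_point P ts j"
    using index[of "horizon P"] set by auto
  then show "time_point P ts (num_intervals P ts) = horizon P"
    using mono[of j "num_intervals P ts"] bounds[OF in_set[of "num_intervals P ts"]]
    by (cases "j = num_intervals P ts") auto
qed

text \<open>The configuration changes only when \<tau> passes a start or a completion. These are all
  time points, and none lies strictly between two consecutive ones.\<close>

lemma closed_arcs_between_time_points:
  assumes ts: "ts \<in> feasible_starts P"
    and i: "i \<in> {1..num_intervals P ts}"
    and \<tau>: "time_point P ts (i - 1) < \<tau>" "\<tau> \<le> time_point P ts i"
  shows "closed_arcs P ts \<tau> = closed_arcs P ts (time_point P ts i)"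
proof -
  have *: "x < \<tau> \<longleftrightarrow> x < time_point P ts i" if x: "x \<in> set (time_points P ts)" for x
  proof -
    obtain j where j: "j \<le> num_intervals P ts" "x = time_point P ts j"
      using time_point_index[OF ts x] by blast
    consider "j < i - 1" | "j = i - 1" | "j = i" | "i < j" by linarith
    then show ?thesis
      using \<tau> j i diff_le_self[of i 1] time_point_strict_mono[OF ts, of j "i - 1"]
        time_point_strict_mono[OF ts, of i j]
      by cases (fastforce intro: less_trans dest: less_le_trans)+
  qed
  have "ts a \<in> set (time_points P ts)" "ts a + processing_time P a \<in> set (time_points P ts)"
    if "a \<in> job_arcs P" for a
    using that set_time_points[OF ts] by auto
  from this[THEN *] show ?thesis
    unfolding closed_arcs_def by (auto simp: not_less[symmetric])
qed

text \<open>Only storage couples different intervals. Without it the linear program splits into one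
  flow problem per interval, and division by the interval length turns amounts into rates.\<close>

lemma feasible_flow_iff_unit_flows:
  assumes ts: "ts \<in> feasible_starts P" and W: "storage P = {}"
  shows "feasible_flow P ts x y \<longleftrightarrow>
    (\<forall>i \<in> {1..num_intervals P ts}.
       unit_flow P (closed_arcs P ts (time_point P ts i))
         (\<lambda>a. x a i / (time_point P ts i - time_point P ts (i - 1))))"
proof -
  define L where "L i = time_point P ts i - time_point P ts (i - 1)" for i
  have L: "0 < L i" if "i \<in> {1..num_intervals P ts}" for i
    using that time_point_strict_mono[OF ts, of "i - 1" i] by (simp add: L_def)
  have unit: "unit_flow P (closed_arcs P ts (time_point P ts i)) (\<lambda>a. x a i / L i) \<longleftrightarrow>
      (\<forall>a \<in> arcs (network P). 0 \<le> x a i \<and>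
         x a i \<le> (if a \<in> job_arcs P \<and> i \<in> closed_intervals P ts a then 0
           else L i * arc_capacity P a)) \<and>
      (\<forall>v \<in> verts (network P) - {source P, sink P}.
        (\<Sum>a \<in> out_arcs (network P) v. x a i) = (\<Sum>a \<in> in_arcs (network P) v. x a i))"
    if i: "i \<in> {1..num_intervals P ts}" for i
    using i L[OF i]
    by (simp add: unit_flow_def sum_divide_distrib[symmetric] closed_arcs_def closed_intervals_def
        field_simps)
  have "feasible_flow P ts x y \<longleftrightarrow> (\<forall>i \<in> {1..num_intervals P ts}.
      (\<forall>a \<in> arcs (network P). 0 \<le> x a i \<and>
         x a i \<le> (if a \<in> job_arcs P \<and> i \<in> closed_intervals P ts a then 0
           else L i * arc_capacity P a)) \<and>
      (\<forall>v \<in> verts (network P) - {source P, sink P}.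
        (\<Sum>a \<in> out_arcs (network P) v. x a i) = (\<Sum>a \<in> in_arcs (network P) v. x a i)))"
    (is "_ \<longleftrightarrow> ?R")
  proof
    assume F: "feasible_flow P ts x y"
    show ?R
      using F job_arcs_subset W unfolding feasible_flow_def Let_def L_def[symmetric] by auto
  next
    assume R: ?R
    have bound: "x a i \<le> (if a \<in> job_arcs P \<and> i \<in> closed_intervals P ts a then 0
        else L i * arc_capacity P a)"
      and nonneg: "0 \<le> x a i"
      if "a \<in> arcs (network P)" "i \<in> {1..num_intervals P ts}" for a i
      using R that by blast+
    \<comment> \<open>The linear program demands equality on closed intervals, whereas
      \<open>unit_flow\<close> only bounds by 0 from above; nonnegativity closes the gap.\<close>
    have "x a i = 0" if "a \<in> job_arcs P" "i \<in> closed_intervals P ts a" for a i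
    proof -
      have "i \<in> {1..num_intervals P ts}" using that by (simp add: closed_intervals_def)
      then show ?thesis using bound[of a i] nonneg[of a i] that job_arcs_subset by auto
    qed
    moreover have "x a i \<le> L i * arc_capacity P a"
      if "a \<in> job_arcs P" "i \<in> {1..num_intervals P ts} - closed_intervals P ts a" for a i
      using bound[of a i] that job_arcs_subset by auto
    moreover have "x a i \<le> L i * arc_capacity P a"
      if "a \<in> arcs (network P) - job_arcs P" "i \<in> {1..num_intervals P ts}" for a i
      using bound[of a i] that by auto
    ultimately show "feasible_flow P ts x y"
      using R W unfolding feasible_flow_def Let_def L_def[symmetric] by simp
  qed
  also have "\<dots> \<longleftrightarrow> (\<forall>i \<in> {1..num_intervals P ts}.
      unit_flow P (closed_arcs P ts (time_point P ts i)) (\<lambda>a. x a i / L i))"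
    by (intro ball_cong refl unit[symmetric])
  finally show ?thesis unfolding L_def .
qed

text \<open>Since the intervals are independent, the total is maximal when the rate is maximal on
  each of them.\<close>

lemma schedule_value_eq_sum:
  assumes ts: "ts \<in> feasible_starts P" and W: "storage P = {}"
  shows "schedule_value P ts = (\<Sum>i = 1..num_intervals P ts.
    (time_point P ts i - time_point P ts (i - 1))
      * max_flow_rate P (closed_arcs P ts (time_point P ts i)))"
proof -
  define L where "L i = time_point P ts i - time_point P ts (i - 1)" for i
  define S where "S i = closed_arcs P ts (time_point P ts i)" for i
  have L: "0 < L i" if "i \<in> {1..num_intervals P ts}" for i
    using that time_point_strict_mono[OF ts, of "i - 1" i] by (simp add: L_def)
  have val: "flow_value P ts x =
      (\<Sum>i = 1..num_intervals P ts. L i * net_outflow P (\<lambda>a. x a i / L i))" for x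
    unfolding flow_value_def
  proof (rule sum.cong[OF refl])
    fix i assume i: "i \<in> {1..num_intervals P ts}"
    show "(\<Sum>a \<in> out_arcs (network P) (source P). x a i)
        - (\<Sum>a \<in> in_arcs (network P) (source P). x a i) = L i * net_outflow P (\<lambda>a. x a i / L i)"
      using L[OF i] by (simp add: net_outflow_def sum_divide_distrib[symmetric] right_diff_distrib)
  qed
  note feas = feasible_flow_iff_unit_flows[OF ts W, folded L_def S_def]
  obtain f where f: "\<And>i. unit_flow P (S i) (f i)" "\<And>i. net_outflow P (f i) = max_flow_rate P (S i)"
  proof -
    have "\<forall>i. \<exists>f. unit_flow P (S i) f \<and> net_outflow P f = max_flow_rate P (S i)"
      using max_flow_rate_attained by blast
    from choice[OF this] show thesis using that by blast
  qed
  \<comment> \<open>An optimal solution: in interval \<open>i\<close> a maximum flow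
    \<open>f i\<close> for its open arcs runs at constant rate.\<close>
  define x where "x a i = L i * f i a" for a i
  have x: "(\<lambda>a. x a i / L i) = f i" if "i \<in> {1..num_intervals P ts}" for i
    using L[OF that] by (simp add: x_def)
  show ?thesis
    unfolding schedule_value_def L_def[symmetric] S_def[symmetric]
  proof (rule Greatest_equality)
    have "feasible_flow P ts x (\<lambda>_ _. 0)" unfolding feas using x f(1) by simp
    moreover have "flow_value P ts x =
        (\<Sum>i = 1..num_intervals P ts. L i * max_flow_rate P (S i))"
      unfolding val using x f(2) by (intro sum.cong) auto
    ultimately show "\<exists>x y. feasible_flow P ts x y \<and>
        (\<Sum>i = 1..num_intervals P ts. L i * max_flow_rate P (S i)) = flow_value P ts x"
      by metis
  next
    fix z assume "\<exists>x y. feasible_flow P ts x y \<and> z = flow_value P ts x"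
    then obtain x y where z: "feasible_flow P ts x y" "z = flow_value P ts x" by blast
    show "z \<le> (\<Sum>i = 1..num_intervals P ts. L i * max_flow_rate P (S i))"
      unfolding z(2) val
      using z(1)[unfolded feas] L max_flow_rate_upper
      by (intro sum_mono mult_left_mono) (auto simp: less_imp_le)
  qed
qed

end

text \<open>Induction on \<open>n\<close>, appending one interval at a time. The first conjunct is
  carried along because gluing two integrals requires ordered endpoints.\<close>

lemma has_integral_step_function:
  fixes g :: "real \<Rightarrow> real" and t :: "nat \<Rightarrow> real"
  assumes "\<And>i. i \<in> {1..n} \<Longrightarrow> t (i - 1) \<le> t i"
    and "\<And>i \<tau>. \<lbrakk>i \<in> {1..n}; t (i - 1) < \<tau>; \<tau> \<le> t i\<rbrakk> \<Longrightarrow> g \<tau> = c i"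
  shows "t 0 \<le> t n \<and> (g has_integral (\<Sum>i = 1..n. (t i - t (i - 1)) * c i)) {t 0..t n}"
  using assms
proof (induction n)
  case 0
  show ?case using has_integral_refl(2)[of g "t 0"] by simp
next
  case (Suc n)
  have IH: "t 0 \<le> t n" "(g has_integral (\<Sum>i = 1..n. (t i - t (i - 1)) * c i)) {t 0..t n}"
    using Suc by auto
  have le: "t n \<le> t (Suc n)" using Suc.prems(1)[of "Suc n"] by simp
  have "((\<lambda>_. c (Suc n)) has_integral (t (Suc n) - t n) * c (Suc n)) {t n..t (Suc n)}"
    using has_integral_const_real[of "c (Suc n)" "t n" "t (Suc n)"] le by simp
  \<comment> \<open>At the left end \<open>t n\<close> the function may still have the value of the
    previous piece; a single point does not affect the integral.\<close>
  then have "(g has_integral (t (Suc n) - t n) * c (Suc n)) {t n..t (Suc n)}"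
    by (rule has_integral_spike_finite[where S = "{t n}", rotated 2])
      (use Suc.prems(2)[of "Suc n"] in auto)
  from has_integral_combine[OF IH(1) le IH(2) this] show ?case using IH(1) le by simp
qed

context maintenance_problem
begin

text \<open>The integral no longer refers to the time points of the particular schedule, so it can
  also be evaluated on other grids and compared between schedules.\<close>

lemma schedule_value_has_integral:
  assumes "ts \<in> feasible_starts P" and "storage P = {}"
  shows "((\<lambda>\<tau>. max_flow_rate P (closed_arcs P ts \<tau>)) has_integral schedule_value P ts)
    {0..horizon P}"
proof -
  have le: "time_point P ts (i - 1) \<le> time_point P ts i" if "i \<in> {1..num_intervals P ts}" for i
    using time_point_strict_mono[OF assms(1), of "i - 1" i] that by simp
  have const: "max_flow_rate P (closed_arcs P ts \<tau>) =
      max_flow_rate P (closed_arcs P ts (time_point P ts i))"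
    if "i \<in> {1..num_intervals P ts}" "time_point P ts (i - 1) < \<tau>" "\<tau> \<le> time_point P ts i" for i \<tau>
    using closed_arcs_between_time_points[OF assms(1) that] by (rule arg_cong)
  show ?thesis
    using has_integral_step_function[where n = "num_intervals P ts" and t = "time_point P ts"
        and g = "\<lambda>\<tau>. max_flow_rate P (closed_arcs P ts \<tau>)"
        and c = "\<lambda>i. max_flow_rate P (closed_arcs P ts (time_point P ts i))", OF le const]
    unfolding schedule_value_eq_sum[OF assms] time_point_0[OF assms(1)] time_point_last[OF assms(1)]
    by (rule conjunct2)
qed

section \<open>Rounding\<close>

text \<open>All jobs share the offset \<theta>, so jobs are rounded consistently with each other.
  The restriction to \<open>job_arcs P\<close> is there because \<open>feasible_starts\<close>
  consists of extensional functions.\<close>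

definition rounded_starts :: "('a \<Rightarrow> real) \<Rightarrow> real \<Rightarrow> 'a \<Rightarrow> real" where
  "rounded_starts ts \<theta> = (\<lambda>a \<in> job_arcs P. of_int \<lfloor>ts a + \<theta>\<rfloor>)"

text \<open>The bounds on a start time are integers. The lower one survives adding \<theta> and
  taking the floor, and the upper one survives because \<theta> is less than 1.\<close>

lemma rounded_starts_feasible:
  assumes ts: "ts \<in> feasible_starts P" and int: "integral_data P" and \<theta>: "0 \<le> \<theta>" "\<theta> < 1"
  shows "rounded_starts ts \<theta> \<in> feasible_starts P"
proof -
  have "release_time P a \<le> of_int \<lfloor>ts a + \<theta>\<rfloor> \<and>
      of_int \<lfloor>ts a + \<theta>\<rfloor> \<le> deadline P a - processing_time P a"
    if a: "a \<in> job_arcs P" for a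
  proof -
    have "release_time P a \<in> \<int>" "deadline P a - processing_time P a \<in> \<int>"
      using int a by (auto simp: integral_data_def)
    then obtain r e where re: "release_time P a = of_int r"
      "deadline P a - processing_time P a = of_int e" by (auto elim!: Ints_cases)
    have "of_int r \<le> ts a" "ts a \<le> of_int e"
      using ts a re by (force simp: feasible_starts_def PiE_iff)+
    then have "r \<le> \<lfloor>ts a + \<theta>\<rfloor>" "\<lfloor>ts a + \<theta>\<rfloor> \<le> e" using \<theta> by linarith+
    then show ?thesis unfolding re by simp
  qed
  then show ?thesis by (auto simp: feasible_starts_def rounded_starts_def)
qed

text \<open>With \<open>m\<close> the rounded start and \<open>p\<close> the integral processing
  time, both sides reduce to the same integer inequalities \<open>m \<le> k\<close> and
  \<open>k + 1 \<le> m + p\<close>.\<close>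

lemma closed_arcs_rounded_starts:
  assumes int: "integral_data P" and \<tau>: "real k < \<tau>" "\<tau> \<le> real k + 1"
  shows "closed_arcs P (rounded_starts ts \<theta>) \<tau> = closed_arcs P ts (real k + 1 - \<theta>)"
proof -
  have "of_int \<lfloor>ts a + \<theta>\<rfloor> < \<tau> \<and> \<tau> \<le> of_int \<lfloor>ts a + \<theta>\<rfloor> + processing_time P a \<longleftrightarrow>
      ts a < real k + 1 - \<theta> \<and> real k + 1 - \<theta> \<le> ts a + processing_time P a"
    if a: "a \<in> job_arcs P" for a
  proof -
    have "processing_time P a \<in> \<int>" using int a by (auto simp: integral_data_def)
    then obtain p where p: "processing_time P a = of_int p" by (auto elim!: Ints_cases)
    define m where "m = \<lfloor>ts a + \<theta>\<rfloor>"
    have m: "of_int m \<le> ts a + \<theta>" "ts a + \<theta> < of_int m + 1" unfolding m_def by linarith+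
    have "real_of_int m < \<tau> \<longleftrightarrow> m \<le> int k" using \<tau> by linarith
    moreover have "ts a < real k + 1 - \<theta> \<longleftrightarrow> m \<le> int k" using m by linarith
    moreover have "\<tau> \<le> real_of_int m + real_of_int p \<longleftrightarrow> int k + 1 \<le> m + p" using \<tau> by linarith
    moreover have "real k + 1 - \<theta> \<le> ts a + real_of_int p \<longleftrightarrow> int k + 1 \<le> m + p"
      using m by linarith
    ultimately show ?thesis unfolding p m_def by blast
  qed
  then show ?thesis by (auto simp: closed_arcs_def rounded_starts_def)
qed

lemma horizon_nat:
  assumes "integral_data P"
  obtains m where "horizon P = real m"
proof -
  have "horizon P \<in> \<int>" using assms by (simp add: integral_data_def)
  then obtain z where "horizon P = of_int z" by (auto elim: Ints_cases)
  then show thesis using horizon_pos that[of "nat z"] by simp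
qed

text \<open>On each unit interval the rounded schedule has a constant configuration, so its integral
  can be computed on the integer grid. Uniqueness of the integral makes a comparison of this grid
  with its time points unnecessary.\<close>

lemma schedule_value_rounded_starts:
  assumes "ts \<in> feasible_starts P" "integral_data P" "storage P = {}" "horizon P = real m"
    and "0 \<le> \<theta>" "\<theta> < 1"
  shows "schedule_value P (rounded_starts ts \<theta>) =
    (\<Sum>i = 1..m. max_flow_rate P (closed_arcs P ts (real i - \<theta>)))"
proof -
  let ?g = "\<lambda>\<tau>. max_flow_rate P (closed_arcs P (rounded_starts ts \<theta>) \<tau>)"
  have "?g \<tau> = max_flow_rate P (closed_arcs P ts (real i - \<theta>))"
    if "i \<in> {1..m}" "real (i - 1) < \<tau>" "\<tau> \<le> real i" for i \<tau>
    using closed_arcs_rounded_starts[OF assms(2), of "i - 1" \<tau> ts \<theta>] that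
    by (simp add: of_nat_diff)
  from has_integral_step_function[of m real ?g, OF _ this]
  have "(?g has_integral (\<Sum>i = 1..m. (real i - real (i - 1)) *
      max_flow_rate P (closed_arcs P ts (real i - \<theta>)))) {0..real m}" by simp
  moreover have "(\<Sum>i = 1..m. (real i - real (i - 1)) *
        max_flow_rate P (closed_arcs P ts (real i - \<theta>))) =
      (\<Sum>i = 1..m. max_flow_rate P (closed_arcs P ts (real i - \<theta>)))"
    by (intro sum.cong) (auto simp: of_nat_diff)
  ultimately show ?thesis
    using schedule_value_has_integral[OF rounded_starts_feasible[OF assms(1,2,5,6)] assms(3)]
      assms(4) has_integral_unique by metis
qed

end

text \<open>As \<theta> runs through the unit interval, \<open>i - \<theta>\<close> sweeps the
  \<open>i\<close>-th unit interval backwards; together these cover the whole range.\<close>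

lemma has_integral_sum_unit_translates:
  fixes g :: "real \<Rightarrow> real"
  assumes "g integrable_on {0..real m}"
  shows "((\<lambda>\<theta>. \<Sum>i = 1..m. g (real i - \<theta>)) has_integral integral {0..real m} g) {0..1}"
  using assms
proof (induction m)
  case 0
  then show ?case by simp
next
  case (Suc m)
  have int: "g integrable_on {0..real m}" "g integrable_on {real m..real (Suc m)}"
    using integrable_on_subinterval[OF Suc.prems] by auto
  have "((\<lambda>\<theta>. g (real (Suc m) - \<theta>)) has_integral integral {real m..real (Suc m)} g) {0..1}"
  proof -
    have "(g has_integral integral {real m..real (Suc m)} g) (cbox (real m) (real (Suc m)))"
      using int(2) by (simp add: integrable_integral)
    \<comment> \<open>The substitution has slope -1, hence scaling factor 1, and maps the last unit
      interval onto \<open>{0..1}\<close>.\<close>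
    from has_integral_affinity[OF this, of "- 1" "real (Suc m)"]
    have "((\<lambda>\<theta>. g (- \<theta> + real (Suc m))) has_integral integral {real m..real (Suc m)} g)
        ((\<lambda>x. real (Suc m) - x) ` {real m..real (Suc m)})"
      by (simp add: algebra_simps)
    moreover have "(\<lambda>x. real (Suc m) - x) ` {real m..real (Suc m)} = {0..1}"
      by (simp add: image_diff_atLeastAtMost)
    ultimately show ?thesis by (simp add: algebra_simps)
  qed
  from has_integral_add[OF Suc.IH[OF int(1)] this]
  show ?case
    using Henstock_Kurzweil_Integration.integral_combine[OF _ _ Suc.prems, of "real m"] by simp
qed

section \<open>Comparison with the finitely many integral schedules\<close>

context maintenance_problem
begin

definition integral_starts :: "('a \<Rightarrow> real) set" where
  "integral_starts = {ts \<in> feasible_starts P. \<forall>a \<in> job_arcs P. ts a \<in> \<int>}"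

lemma rounded_starts_integral:
  assumes "ts \<in> feasible_starts P" "integral_data P" "0 \<le> \<theta>" "\<theta> < 1"
  shows "rounded_starts ts \<theta> \<in> integral_starts"
  using rounded_starts_feasible[OF assms] by (auto simp: integral_starts_def rounded_starts_def)

text \<open>Each start time has finitely many integer choices, and extensionality leaves no freedom
  outside \<open>job_arcs P\<close>.\<close>

lemma finite_integral_starts: "finite integral_starts"
proof -
  have "integral_starts \<subseteq> (\<Pi>\<^sub>E a \<in> job_arcs P.
      {k \<in> \<int>. release_time P a \<le> k \<and> k \<le> deadline P a - processing_time P a})"
    by (simp add: integral_starts_def feasible_starts_def PiE_iff subset_iff)
  then show ?thesis
    by (rule finite_subset) (intro finite_PiE finite_job_arcs finite_int_segment)
qed

text \<open>An average cannot exceed the largest of the averaged values: \<open>?h\<close>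
  integrates over \<open>{0..1}\<close> to the value of \<open>ts\<close>, and for \<theta> below 1
  it takes only values of integral schedules.\<close>

lemma integral_starts_dominate:
  assumes ts: "ts \<in> feasible_starts P" and int: "integral_data P" and W: "storage P = {}"
  shows "\<exists>ts' \<in> integral_starts. schedule_value P ts \<le> schedule_value P ts'"
proof -
  obtain m where m: "horizon P = real m" using horizon_nat[OF int] .
  let ?g = "\<lambda>\<tau>. max_flow_rate P (closed_arcs P ts \<tau>)"
  let ?h = "\<lambda>\<theta>. \<Sum>i = 1..m. ?g (real i - \<theta>)"
  let ?V = "schedule_value P ` integral_starts"
  have g: "(?g has_integral schedule_value P ts) {0..real m}"
    using schedule_value_has_integral[OF ts W] m by simp
  have h: "(?h has_integral schedule_value P ts) {0..1}"
    using has_integral_sum_unit_translates[of ?g m] g by (metis has_integral_iff)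
  have fin: "finite ?V" using finite_integral_starts by simp
  have in_V: "?h \<theta> \<in> ?V" if "0 \<le> \<theta>" "\<theta> < 1" for \<theta>
    using schedule_value_rounded_starts[OF ts int W m that] rounded_starts_integral[OF ts int that]
    by (metis imageI)
  \<comment> \<open>The rounding with \<theta> = 0 shows that \<open>?V\<close> is nonempty.\<close>
  have "Max ?V \<in> ?V" using Max_in[OF fin] in_V[of 0] by fastforce
  \<comment> \<open>Capping alters the integrand at most at \<open>\<theta> = 1\<close>, where it is not the value of a rounding.\<close>
  have "((\<lambda>\<theta>. min (?h \<theta>) (Max ?V)) has_integral schedule_value P ts) {0..1}"
    by (rule has_integral_spike_finite[OF _ _ h, where S = "{1}"])
      (use in_V Max_ge[OF fin] in \<open>auto simp: min_absorb1\<close>)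
  moreover have "((\<lambda>_. Max ?V) has_integral Max ?V) {0..1::real}"
    using has_integral_const_real[of "Max ?V" 0 1] by simp
  ultimately have "schedule_value P ts \<le> Max ?V"
    by (rule has_integral_le) simp
  with \<open>Max ?V \<in> ?V\<close> show ?thesis by auto
qed

lemma integral_optimal_solution_exists:
  assumes int: "integral_data P" and W: "storage P = {}"
  shows "\<exists>ts. optimal_solution P ts \<and> (\<forall>a \<in> job_arcs P. ts a \<in> \<int>)"
proof -
  \<comment> \<open>Starting every job at its release time gives a feasible schedule; an integral
    schedule dominating it shows that the maximum below is over a nonempty set.\<close>
  have "restrict (release_time P) (job_arcs P) \<in> feasible_starts P"
    using release_time_le by (auto simp: feasible_starts_def)
  from integral_starts_dominate[OF this int W] have "integral_starts \<noteq> {}" by blast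
  then obtain ts where ts: "ts \<in> integral_starts"
    "schedule_value P ts = Max (schedule_value P ` integral_starts)"
    using Max_in[of "schedule_value P ` integral_starts"] finite_integral_starts by fastforce
  then have max: "schedule_value P ts' \<le> schedule_value P ts" if "ts' \<in> integral_starts" for ts'
    using finite_integral_starts that by simp
  have "schedule_value P ts' \<le> schedule_value P ts" if "ts' \<in> feasible_starts P" for ts'
    using integral_starts_dominate[OF that int W] max order_trans by blast
  then have "optimal_solution P ts"
    using ts(1) by (auto simp: optimal_solution_def is_arg_max_def integral_starts_def not_less)
  then show ?thesis using ts(1) by (auto simp: integral_starts_def)
qed

end

theorem proposition1:
  fixes P :: "('v, 'a) maintenance_instance"
  assumes "maintenance_problem P"
    and "integral_data P"
    and "storage P = {}"
  shows "\<exists>ts. optimal_solution P ts \<and> (\<forall>a \<in> job_arcs P. ts a \<in> \<int>)"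
  using maintenance_problem.integral_optimal_solution_exists[OF assms] .

end
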